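(* A syllogism is valid if and only if it is provable in the formal system SYLL.
   Context: **Categorical propositions.** For term-variables $A,B$ there are four categorical propositions with subject $A$ and predicate $B$: $\mathbf{A}_{AB}$ (Each $A$ is $B$), $\mathbf{E}_{AB}$ (No $A$ is $B$), $\mathbf{I}_{AB}$ (Some $A$ is $B$), $\mathbf{O}_{AB}$ (Some $A$ is not $B$). The propositions $\mathbf{I}$ and $\mathbf{O}$ are particular and $\mathbf{A}$ and $\mathbf{E}$ are universal. **Syllogisms.** Let $S,P,M$ be three distinct term-variables. A syllogism is an expression $P_1,P_2\vdash C$ with $P_1,P_2,C$ categorical propositions, where the first premise $P_1$ involves exactly $M$ and $P$ (in either order, as subject and predicate), the second premise $P_2$ involves exactly $S$ and $M$ (in either order), and the conclusion $C$ has subject $S$ and predicate $P$. Its mood is the sequence of kinds of $P_1,P_2,C$. Its figure is: fig. 1 if the premises have (subject, predicate) $MP,SM$; fig. 2 if $PM,SM$; fig. 3 if $MP,MS$; fig. 4 if $PM,MS$. So there are $4^3\cdot 4=256$ syllogisms. **Valid syllogisms.** The valid syllogisms (without existential import) are exactly the following 15: - Fig. 1: $\mathbf{A}_{MP},\mathbf{A}_{SM}\vdash\mathbf{A}_{SP}$; $\mathbf{E}_{MP},\mathbf{A}_{SM}\vdash\mathbf{E}_{SP}$; $\mathbf{A}_{MP},\mathbf{I}_{SM}\vdash\mathbf{I}_{SP}$; $\mathbf{E}_{MP},\mathbf{I}_{SM}\vdash\mathbf{O}_{SP}$. - Fig. 2: $\mathbf{E}_{PM},\mathbf{A}_{SM}\vdash\mathbf{E}_{SP}$;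 $\mathbf{A}_{PM},\mathbf{E}_{SM}\vdash\mathbf{E}_{SP}$; $\mathbf{E}_{PM},\mathbf{I}_{SM}\vdash\mathbf{O}_{SP}$; $\mathbf{A}_{PM},\mathbf{O}_{SM}\vdash\mathbf{O}_{SP}$. - Fig. 3: $\mathbf{I}_{MP},\mathbf{A}_{MS}\vdash\mathbf{I}_{SP}$; $\mathbf{A}_{MP},\mathbf{I}_{MS}\vdash\mathbf{I}_{SP}$; $\mathbf{O}_{MP},\mathbf{A}_{MS}\vdash\mathbf{O}_{SP}$; $\mathbf{E}_{MP},\mathbf{I}_{MS}\vdash\mathbf{O}_{SP}$. - Fig. 4: $\mathbf{A}_{PM},\mathbf{E}_{MS}\vdash\mathbf{E}_{SP}$; $\mathbf{I}_{PM},\mathbf{A}_{MS}\vdash\mathbf{I}_{SP}$; $\mathbf{E}_{PM},\mathbf{I}_{MS}\vdash\mathbf{O}_{SP}$. **Diagrams of SYLL.** The syntactic primitives are the symbols $\to$, $\leftarrow$, $\bullet$ and countably many term-variables $A,B,C,\dots$. A diagram is a finite list of arrow symbols ($\to$ or $\leftarrow$) separated by a single bullet or term-variable, beginning and ending at a term-variable (a single term-variable is a diagram). A part of a diagram is a finite list of consecutive components of it; parts are denoted $\mathcal{D},\mathcal{E}$. The categorical propositions are represented by the syllogistic diagrams $$\mathbf{A}_{AB}: A\to B,\quad \mathbf{E}_{AB}: A\to\bullet\leftarrow B,\quad \mathbf{I}_{AB}: A\leftarrow\bullet\to B,\quad \mathbf{O}_{AB}: A\leftarrow\bullet\to\bullet\leftarrow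 B.$$ **Rules of inference of SYLL** (for all term-variables $A,B$ and all parts $\mathcal{D},\mathcal{E}$ such that the expressions are diagrams): 1. from $A\to B$ infer $B\leftarrow A$, and conversely; 2. from $A\to\bullet\leftarrow B$ infer $B\to\bullet\leftarrow A$; 3. from $A\leftarrow\bullet\to B$ infer $B\leftarrow\bullet\to A$; 4. from $A\leftarrow\bullet\to\bullet\leftarrow B$ infer $B\to\bullet\leftarrow\bullet\to A$, and conversely; 5. from the two diagrams $\mathcal{D}A$ and $A\mathcal{E}$ (in either order) infer the diagram $\mathcal{D}A\mathcal{E}$ obtained by overlapping them on the common extremal $A$; 6. from $\mathcal{D}\to A\to\mathcal{E}$ infer $\mathcal{D}\to\mathcal{E}$; 7. from $\mathcal{D}\leftarrow A\leftarrow\mathcal{E}$ infer $\mathcal{D}\leftarrow\mathcal{E}$. **Provability.** A proof tree of SYLL is a tree in which each node is a diagram and each branching is an instance of a rule of inference. A formal proof of a syllogism is a proof tree with (the syllogistic diagram of) its conclusion as the root and with (the syllogistic diagrams of) each of its premises as leaves. A syllogism is provable in SYLL if there is a formal proof for it. *)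

theory Defs
  imports Main
begin

section \<open>Categorical propositions and syllogisms\<close>

type_synonym tvar = nat

text \<open>The arguments are the subject and the predicate, in this order.\<close>

datatype categorical =
    A_prop tvar tvar
  | E_prop tvar tvar
  | I_prop tvar tvar
  | O_prop tvar tvar

fun subject :: "categorical \<Rightarrow> tvar" where
  "subject (A_prop a b) = a"
| "subject (E_prop a b) = a"
| "subject (I_prop a b) = a"
| "subject (O_prop a b) = a"

fun predicate :: "categorical \<Rightarrow> tvar" where
  "predicate (A_prop a b) = b"
| "predicate (E_prop a b) = b"
| "predicate (I_prop a b) = b"
| "predicate (O_prop a b) = b"

datatype syllogism =
  Syllogism (first_premise: categorical) (second_premise: categorical) (conclusion: categorical)

text \<open>The syllogisms on the term-variables \<open>S\<close>, \<open>P\<close>, \<open>M\<close>, which are meant to be distinct.\<close>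

definition syllogisms :: "tvar \<Rightarrow> tvar \<Rightarrow> tvar \<Rightarrow> syllogism set" where
  "syllogisms S P M =
    {Syllogism P1 P2 C | P1 P2 C.
       (subject P1, predicate P1) \<in> {(M, P), (P, M)} \<and>
       (subject P2, predicate P2) \<in> {(S, M), (M, S)} \<and>
       (subject C, predicate C) = (S, P)}"

text \<open>Validity is without existential import. One line for each of the four figures.\<close>

definition valid_syllogisms :: "tvar \<Rightarrow> tvar \<Rightarrow> tvar \<Rightarrow> syllogism set" where
  "valid_syllogisms S P M =
    {Syllogism (A_prop M P) (A_prop S M) (A_prop S P), Syllogism (E_prop M P) (A_prop S M) (E_prop S P),
     Syllogism (A_prop M P) (I_prop S M) (I_prop S P), Syllogism (E_prop M P) (I_prop S M) (O_prop S P)} \<union>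
    {Syllogism (E_prop P M) (A_prop S M) (E_prop S P), Syllogism (A_prop P M) (E_prop S M) (E_prop S P),
     Syllogism (E_prop P M) (I_prop S M) (O_prop S P), Syllogism (A_prop P M) (O_prop S M) (O_prop S P)} \<union>
    {Syllogism (I_prop M P) (A_prop M S) (I_prop S P), Syllogism (A_prop M P) (I_prop M S) (I_prop S P),
     Syllogism (O_prop M P) (A_prop M S) (O_prop S P), Syllogism (E_prop M P) (I_prop M S) (O_prop S P)} \<union>
    {Syllogism (A_prop P M) (E_prop M S) (E_prop S P), Syllogism (I_prop P M) (A_prop M S) (I_prop S P),
     Syllogism (E_prop P M) (I_prop M S) (O_prop S P)}"


section \<open>The formal system SYLL\<close>

text \<open>\<open>Rarr\<close> and \<open>Larr\<close> are the arrow symbols pointing to the right and to the left.\<close>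

datatype symbol = Rarr | Larr | Bullet | Var tvar

definition is_arrow :: "symbol \<Rightarrow> bool" where
  "is_arrow x \<longleftrightarrow> x = Rarr \<or> x = Larr"

definition is_var :: "symbol \<Rightarrow> bool" where
  "is_var x \<longleftrightarrow> (\<exists>a. x = Var a)"

text \<open>Arrows occupy exactly the odd positions, counting from 0. The length is odd, so the list is
  nonempty and both \<open>hd\<close> and \<open>last\<close> are meaningful.\<close>

definition diagram :: "symbol list \<Rightarrow> bool" where
  "diagram w \<longleftrightarrow>
     odd (length w) \<and>
     (\<forall>i < length w. if odd i then is_arrow (w ! i) else w ! i = Bullet \<or> is_var (w ! i)) \<and>
     is_var (hd w) \<and> is_var (last w)"

fun syllogistic_diagram :: "categorical \<Rightarrow> symbol list" where
  "syllogistic_diagram (A_prop a b) = [Var a, Rarr, Var b]"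
| "syllogistic_diagram (E_prop a b) = [Var a, Rarr, Bullet, Larr, Var b]"
| "syllogistic_diagram (I_prop a b) = [Var a, Larr, Bullet, Rarr, Var b]"
| "syllogistic_diagram (O_prop a b) = [Var a, Larr, Bullet, Rarr, Bullet, Larr, Var b]"

text \<open>\<open>infer ps d\<close>: the diagram \<open>d\<close> follows from the list \<open>ps\<close> of diagrams by a single rule of
  inference. The lists \<open>D\<close> and \<open>E\<close> range over the parts of diagrams; that they are parts is
  implied by the requirement that the expressions in which they occur are diagrams.\<close>

inductive infer :: "symbol list list \<Rightarrow> symbol list \<Rightarrow> bool" where
  rule1: "infer [[Var a, Rarr, Var b]] [Var b, Larr, Var a]"
| rule1_conv: "infer [[Var b, Larr, Var a]] [Var a, Rarr, Var b]"
| rule2: "infer [[Var a, Rarr, Bullet, Larr, Var b]] [Var b, Rarr, Bullet, Larr, Var a]"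
| rule3: "infer [[Var a, Larr, Bullet, Rarr, Var b]] [Var b, Larr, Bullet, Rarr, Var a]"
| rule4: "infer [[Var a, Larr, Bullet, Rarr, Bullet, Larr, Var b]]
                [Var b, Rarr, Bullet, Larr, Bullet, Rarr, Var a]"
| rule4_conv: "infer [[Var b, Rarr, Bullet, Larr, Bullet, Rarr, Var a]]
                     [Var a, Larr, Bullet, Rarr, Bullet, Larr, Var b]"
| rule5: "infer [D @ [Var a], [Var a] @ E] (D @ [Var a] @ E)"
    if "diagram (D @ [Var a])" "diagram ([Var a] @ E)" "diagram (D @ [Var a] @ E)"
| rule5_swap: "infer [[Var a] @ E, D @ [Var a]] (D @ [Var a] @ E)"
    if "diagram (D @ [Var a])" "diagram ([Var a] @ E)" "diagram (D @ [Var a] @ E)"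
| rule6: "infer [D @ [Rarr, Var a, Rarr] @ E] (D @ [Rarr] @ E)"
    if "diagram (D @ [Rarr, Var a, Rarr] @ E)" "diagram (D @ [Rarr] @ E)"
| rule7: "infer [D @ [Larr, Var a, Larr] @ E] (D @ [Larr] @ E)"
    if "diagram (D @ [Larr, Var a, Larr] @ E)" "diagram (D @ [Larr] @ E)"

datatype tree = Node (root: "symbol list") (subtrees: "tree list")

fun leaves :: "tree \<Rightarrow> symbol list set" where
  "leaves (Node d ts) = (if ts = [] then {d} else (\<Union>t\<in>set ts. leaves t))"

fun proof_tree :: "tree \<Rightarrow> bool" where
  "proof_tree (Node d ts) \<longleftrightarrow>
     diagram d \<and> (ts \<noteq> [] \<longrightarrow> infer (map root ts) d) \<and> (\<forall>t\<in>set ts. proof_tree t)"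

text \<open>Every leaf is a premise and every premise occurs as a leaf, possibly repeatedly.\<close>

definition formal_proof :: "tree \<Rightarrow> syllogism \<Rightarrow> bool" where
  "formal_proof t \<sigma> \<longleftrightarrow>
     proof_tree t \<and>
     root t = syllogistic_diagram (conclusion \<sigma>) \<and>
     leaves t = {syllogistic_diagram (first_premise \<sigma>), syllogistic_diagram (second_premise \<sigma>)}"

definition provable :: "syllogism \<Rightarrow> bool" where
  "provable \<sigma> \<longleftrightarrow> (\<exists>t. formal_proof t \<sigma>)"

end

theory Submission
  imports Defs
begin

text \<open>For completeness, chaining two premises on the middle term by rule 5 and erasing it by rule 6
  or 7 yields six composition principles, and conversion yields the fifteen moods from them.
  For soundness, read a diagram as the conjunction of its segments, that is, of its parts between
  consecutive term-variables. A set-valued interpretation gives a meaning to the six segments that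
  express categorical propositions, and every other segment is declared true. This is enough
  because erasing a term never produces one of the six from a segment that is not among
  them. Finally, every syllogism that is not in the list is refuted by one of twelve
  interpretations with at most three elements.\<close>

section \<open>Completeness\<close>

text \<open>Equality of \<open>leaves t\<close> with \<open>L\<close>, rather than inclusion, is
  what a formal proof demands, as every premise must be used; so leaf sets combine by union.\<close>

definition derives :: "symbol list set \<Rightarrow> symbol list \<Rightarrow> bool" where
  "derives L d \<longleftrightarrow> (\<exists>t. proof_tree t \<and> root t = d \<and> leaves t = L)"

lemma derives_diagram: "derives L d \<Longrightarrow> diagram d"
  unfolding derives_def by (metis proof_tree.simps tree.collapse)

lemma derives_leaf: "diagram d \<Longrightarrow> derives {d} d"
  unfolding derives_def by (rule exI[of _ "Node d []"]) simp

lemma derives_infer1: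
  assumes "derives L d" "infer [d] e" "diagram e"
  shows "derives L e"
proof -
  obtain t where "proof_tree t" "root t = d" "leaves t = L"
    using assms(1) by (auto simp: derives_def)
  then show ?thesis
    using assms(2,3) unfolding derives_def by (intro exI[of _ "Node e [t]"]) simp
qed

lemma derives_infer2:
  assumes "derives K d" "derives L e" "infer [d, e] f" "diagram f"
  shows "derives (K \<union> L) f"
proof -
  obtain t u where "proof_tree t" "root t = d" "leaves t = K"
    and "proof_tree u" "root u = e" "leaves u = L"
    using assms(1,2) by (auto simp: derives_def)
  then show ?thesis
    using assms(3,4) unfolding derives_def by (intro exI[of _ "Node f [t, u]"]) simp
qed

lemma derives_overlap:
  assumes "derives K (D @ [Var a])" "derives L (Var a # E)" "diagram (D @ Var a # E)"
  shows "derives (K \<union> L) (D @ Var a # E)"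
  using derives_infer2[OF assms(1,2)] rule5[of D a E] assms derives_diagram by fastforce

text \<open>Rule 5 overlaps the diagrams at \<open>Var a\<close>, which then stands between two
  right arrows, so rule 6 erases it. \<open>derives_left\<close> is the mirror image with rule
  7.\<close>

lemma derives_right:
  assumes "derives K (D @ [Rarr, Var a])" "derives L (Var a # Rarr # E)"
    and "diagram (D @ [Rarr, Var a, Rarr] @ E)" "diagram (D @ [Rarr] @ E)"
  shows "derives (K \<union> L) (D @ [Rarr] @ E)"
proof -
  have "derives (K \<union> L) (D @ [Rarr, Var a, Rarr] @ E)"
    using derives_overlap[of K "D @ [Rarr]" a L "Rarr # E"] assms by simp
  then show ?thesis
    using derives_infer1 rule6 assms(3,4) by blast
qed

lemma derives_left:
  assumes "derives K (D @ [Larr, Var a])" "derives L (Var a # Larr # E)"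
    and "diagram (D @ [Larr, Var a, Larr] @ E)" "diagram (D @ [Larr] @ E)"
  shows "derives (K \<union> L) (D @ [Larr] @ E)"
proof -
  have "derives (K \<union> L) (D @ [Larr, Var a, Larr] @ E)"
    using derives_overlap[of K "D @ [Larr]" a L "Larr # E"] assms by simp
  then show ?thesis
    using derives_infer1 rule7 assms(3,4) by blast
qed

lemmas diagram_simps = diagram_def All_less_Suc is_var_def is_arrow_def

lemma diagram_syllogistic_diagram: "diagram (syllogistic_diagram c)"
  by (cases c) (simp_all add: diagram_simps)

section \<open>Conversions and the six composition principles\<close>

abbreviation derives_prop :: "symbol list set \<Rightarrow> categorical \<Rightarrow> bool" where
  "derives_prop L c \<equiv> derives L (syllogistic_diagram c)"

text \<open>Rule 7 erases a term between two left arrows; this reversal supplies one of these arrows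
  in \<open>O_A\<close> and \<open>A_O\<close>.\<close>

lemma A_reversed: "derives_prop L (A_prop a b) \<Longrightarrow> derives L [Var b, Larr, Var a]"
  by (rule derives_infer1) (auto intro: rule1 simp: diagram_simps)

lemma E_conversion: "derives_prop L (E_prop a b) \<Longrightarrow> derives_prop L (E_prop b a)"
  by (rule derives_infer1) (auto intro: rule2 simp: diagram_simps)

lemma I_conversion: "derives_prop L (I_prop a b) \<Longrightarrow> derives_prop L (I_prop b a)"
  by (rule derives_infer1) (auto intro: rule3 simp: diagram_simps)

lemma A_A: "derives_prop K (A_prop a b) \<Longrightarrow> derives_prop L (A_prop b c) \<Longrightarrow>
    derives_prop (K \<union> L) (A_prop a c)"
  using derives_right[of K "[Var a]" b L "[Var c]"] by (simp add: diagram_simps)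

lemma A_E: "derives_prop K (A_prop a b) \<Longrightarrow> derives_prop L (E_prop b c) \<Longrightarrow>
    derives_prop (K \<union> L) (E_prop a c)"
  using derives_right[of K "[Var a]" b L "[Bullet, Larr, Var c]"] by (simp add: diagram_simps)

lemma I_A: "derives_prop K (I_prop a b) \<Longrightarrow> derives_prop L (A_prop b c) \<Longrightarrow>
    derives_prop (K \<union> L) (I_prop a c)"
  using derives_right[of K "[Var a, Larr, Bullet]" b L "[Var c]"] by (simp add: diagram_simps)

lemma I_E: "derives_prop K (I_prop a b) \<Longrightarrow> derives_prop L (E_prop b c) \<Longrightarrow>
    derives_prop (K \<union> L) (O_prop a c)"
  using derives_right[of K "[Var a, Larr, Bullet]" b L "[Bullet, Larr, Var c]"]
  by (simp add: diagram_simps)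

lemma O_A: "derives_prop K (O_prop a b) \<Longrightarrow> derives_prop L (A_prop c b) \<Longrightarrow>
    derives_prop (K \<union> L) (O_prop a c)"
  using derives_left[of K "[Var a, Larr, Bullet, Rarr, Bullet]" b L "[Var c]"] A_reversed
  by (simp add: diagram_simps)

lemma A_O: "derives_prop K (A_prop b a) \<Longrightarrow> derives_prop L (O_prop b c) \<Longrightarrow>
    derives_prop (K \<union> L) (O_prop a c)"
  using derives_left[of K "[Var a]" b L "[Bullet, Rarr, Bullet, Larr, Var c]"] A_reversed
  by (simp add: diagram_simps)

text \<open>The two premises appear as a union of singletons to match the form
  \<open>K \<union> L\<close> of the composition principles.\<close>

lemma provable_iff_derives:
  "provable (Syllogism p q c) \<longleftrightarrow>
    derives_prop ({syllogistic_diagram p} \<union> {syllogistic_diagram q}) c"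
  by (auto simp: provable_def formal_proof_def derives_def insert_commute)

lemma valid_imp_provable:
  assumes "\<sigma> \<in> valid_syllogisms S P M"
  shows "provable \<sigma>"
proof -
  have leaf: "derives_prop {syllogistic_diagram c} c" for c
    by (rule derives_leaf[OF diagram_syllogistic_diagram])
  note leafE = leaf[THEN E_conversion] and leafI = leaf[THEN I_conversion]
  \<comment> \<open>One fact per valid mood: six without conversion, five converting premises only,
    and four converting the conclusion, two of these a premise as well.\<close>
  note direct = A_A[OF leaf leaf] A_E[OF leaf leaf] I_A[OF leaf leaf] I_E[OF leaf leaf]
    O_A[OF leaf leaf] A_O[OF leaf leaf] A_E[OF leaf leafE] I_A[OF leafI leaf]
    I_E[OF leaf leafE] I_E[OF leafI leaf] I_E[OF leafI leafE]
    A_E[OF leaf leaf, THEN E_conversion] A_E[OF leaf leafE, THEN E_conversion]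
    I_A[OF leaf leaf, THEN I_conversion] I_A[OF leafI leaf, THEN I_conversion]
  show ?thesis
    using assms unfolding valid_syllogisms_def
    \<comment> \<open>Composition takes the premises in chaining order, whereas a syllogism lists
      the one with \<open>P\<close> first; where these differ, the union is commuted.\<close>
    by (elim UnE insertE emptyE)
      (hypsubst, unfold provable_iff_derives, (rule direct | subst Un_commute, rule direct))+
qed

section \<open>Soundness\<close>

fun holds :: "(tvar \<Rightarrow> 'a set) \<Rightarrow> categorical \<Rightarrow> bool" where
  "holds v (A_prop a b) \<longleftrightarrow> v a \<subseteq> v b"
| "holds v (E_prop a b) \<longleftrightarrow> v a \<inter> v b = {}"
| "holds v (I_prop a b) \<longleftrightarrow> v a \<inter> v b \<noteq> {}"
| "holds v (O_prop a b) \<longleftrightarrow> \<not> v a \<subseteq> v b"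

text \<open>The second and the last clause are mirror images of the A and O segments, whence the
  swapped arguments; the E and I segments are their own mirror images.\<close>

definition segment_holds :: "(tvar \<Rightarrow> 'a set) \<Rightarrow> tvar \<Rightarrow> symbol list \<Rightarrow> tvar \<Rightarrow> bool" where
  "segment_holds v a u b \<longleftrightarrow>
    (u = [Rarr] \<longrightarrow> holds v (A_prop a b)) \<and>
    (u = [Larr] \<longrightarrow> holds v (A_prop b a)) \<and>
    (u = [Rarr, Bullet, Larr] \<longrightarrow> holds v (E_prop a b)) \<and>
    (u = [Larr, Bullet, Rarr] \<longrightarrow> holds v (I_prop a b)) \<and>
    (u = [Larr, Bullet, Rarr, Bullet, Larr] \<longrightarrow> holds v (O_prop a b)) \<and>
    (u = [Rarr, Bullet, Larr, Bullet, Rarr] \<longrightarrow> holds v (O_prop b a))"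

text \<open>The parts \<open>u\<close> need not avoid term-variables, since \<^const>\<open>segment_holds\<close> is true
  when \<open>u\<close> contains one.\<close>

definition diagram_holds :: "(tvar \<Rightarrow> 'a set) \<Rightarrow> symbol list \<Rightarrow> bool" where
  "diagram_holds v w \<longleftrightarrow> (\<forall>xs a u b ys. w = xs @ Var a # u @ Var b # ys \<longrightarrow> segment_holds v a u b)"

lemma segment_holds_Var: "Var x \<in> set u \<Longrightarrow> segment_holds v a u b"
  by (auto simp: segment_holds_def)

text \<open>If \<open>p @ Rarr # q\<close> is one of the six segments, then so are both pieces. The
  cases are A with A, A with E, I with A, I with E, and the mirrored O with A on either
  side.\<close>

lemma segment_holds_right:
  assumes "segment_holds v a (p @ [Rarr]) x" "segment_holds v x (Rarr # q) b"
  shows "segment_holds v a (p @ Rarr # q) b"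
  using assms unfolding segment_holds_def
  by (auto simp: append_eq_Cons_conv Cons_eq_append_conv)

lemma segment_holds_left:
  assumes "segment_holds v a (p @ [Larr]) x" "segment_holds v x (Larr # q) b"
  shows "segment_holds v a (p @ Larr # q) b"
  using assms unfolding segment_holds_def
  by (auto simp: append_eq_Cons_conv Cons_eq_append_conv)

lemma diagram_holdsD:
  "diagram_holds v (xs @ Var a # u @ Var b # ys) \<Longrightarrow> segment_holds v a u b"
  unfolding diagram_holds_def by blast

text \<open>A segment of \<open>D @ s # E\<close> lies in \<open>D @ [s]\<close>, lies in \<open>s # E\<close>, or
  contains \<open>s\<close> in its interior.\<close>

lemma diagram_holds_appendI:
  assumes D: "diagram_holds v (D @ [s])" and E: "diagram_holds v (s # E)"
    and across: "\<And>xs a p q b ys. D = xs @ Var a # p \<Longrightarrow> E = q @ Var b # ys \<Longrightarrow>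
      segment_holds v a (p @ s # q) b"
  shows "diagram_holds v (D @ s # E)"
  unfolding diagram_holds_def
proof (intro allI impI)
  fix xs a u b ys
  assume eq: "D @ s # E = xs @ Var a # u @ Var b # ys"
  show "segment_holds v a u b"
  proof (cases "length D \<le> length xs")
    case True
    then obtain zs where "xs = D @ zs" "s # E = zs @ Var a # u @ Var b # ys"
      using eq by (auto simp: append_eq_append_conv2)
    then show ?thesis
      using diagram_holdsD E by metis
  next
    case False
    then obtain zs where "D = xs @ zs" "zs \<noteq> []" "zs @ s # E = Var a # u @ Var b # ys"
      using eq by (auto simp: append_eq_append_conv2)
    then obtain p where p: "D = xs @ Var a # p" "p @ s # E = u @ Var b # ys"
      by (cases zs) auto
    show ?thesis
    \<comment> \<open>If the lengths agree, \<open>s\<close> is the end variable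
      \<open>Var b\<close> itself, and the segment still lies in \<open>D @ [s]\<close>.\<close>
    proof (cases "length u \<le> length p")
      case True
      then obtain zs where "p = u @ zs" "zs @ s # E = Var b # ys"
        using p(2) by (auto simp: append_eq_append_conv2)
      then have "\<exists>ys'. D @ [s] = xs @ Var a # u @ Var b # ys'"
        using p(1) by (auto simp: append_eq_Cons_conv)
      then show ?thesis
        using diagram_holdsD D by metis
    next
      case False
      then obtain q where "u = p @ s # q" "E = q @ Var b # ys"
        using p(2) by (auto simp: append_eq_append_conv2 Cons_eq_append_conv)
      then show ?thesis
        using across p(1) by simp
    qed
  qed
qed

lemma diagram_holds_infix:
  assumes "diagram_holds v (D @ w @ E)"
  shows "diagram_holds v w"
  unfolding diagram_holds_def
proof (intro allI impI)
  fix xs a u b ys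
  assume "w = xs @ Var a # u @ Var b # ys"
  then show "segment_holds v a u b"
    using assms diagram_holdsD[of v "D @ xs" a u b "ys @ E"] by simp
qed

text \<open>A segment reaching across the junction contains \<open>Var x\<close> and is therefore
  true by default.\<close>

lemma diagram_holds_overlap:
  assumes "diagram_holds v (D @ [Var x])" "diagram_holds v (Var x # E)"
  shows "diagram_holds v (D @ Var x # E)"
  using assms by (rule diagram_holds_appendI) (rule segment_holds_Var[of x], simp)

text \<open>Only segments across the surviving arrow are new; each is composed of the two segments
  that met at the erased term.\<close>

lemma diagram_holds_erase:
  assumes *: "diagram_holds v (D @ [s, Var x, s] @ E)" and "s = Rarr \<or> s = Larr"
  shows "diagram_holds v (D @ [s] @ E)"
proof -
  have "diagram_holds v (D @ [s])"
    using diagram_holds_infix[of v "[]" "D @ [s]" "[Var x, s] @ E"] * by simp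
  moreover have "diagram_holds v (s # E)"
    using diagram_holds_infix[of v "D @ [s, Var x]" "s # E" "[]"] * by simp
  moreover have "segment_holds v a (p @ s # q) b"
    if "D = xs @ Var a # p" "E = q @ Var b # ys" for xs a p q b ys
  proof -
    have "segment_holds v a (p @ [s]) x" "segment_holds v x (s # q) b"
      using * that diagram_holdsD[of v xs a "p @ [s]" x "s # E"]
        diagram_holdsD[of v "D @ [s]" x "s # q" b ys] by simp_all
    then show ?thesis
      using assms(2) segment_holds_right segment_holds_left by metis
  qed
  ultimately show ?thesis
    using diagram_holds_appendI by fastforce
qed

text \<open>The decomposition is unique: anything before \<open>Var c\<close> or after
  \<open>Var d\<close> would force a variable into \<open>u\<close>.\<close>

lemma diagram_holds_single_segment:
  assumes "\<And>x. Var x \<notin> set u"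
  shows "diagram_holds v (Var a # u @ [Var b]) \<longleftrightarrow> segment_holds v a u b"
proof
  assume "segment_holds v a u b"
  moreover have "c = a \<and> w = u \<and> d = b"
    if "Var a # u @ [Var b] = xs @ Var c # w @ Var d # ys" for xs c w d ys
  proof -
    have "xs = []"
    proof (cases xs)
      case (Cons y zs)
      then have "u @ [Var b] = (zs @ Var c # w) @ Var d # ys"
        using that by simp
      then have "Var c \<in> set u"
        by (cases ys rule: rev_cases) (auto simp del: append_assoc simp flip: append_Cons append_assoc)
      then show ?thesis
        using assms by simp
    qed
    moreover have "ys = []"
    proof (cases ys rule: rev_cases)
      case (snoc zs y)
      then have "u = w @ Var d # zs"
        using that \<open>xs = []\<close> by simp
      then show ?thesis
        using assms[of d] by simp
    qed
    ultimately show ?thesis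
      using that by simp
  qed
  ultimately show "diagram_holds v (Var a # u @ [Var b])"
    unfolding diagram_holds_def by metis
qed (use diagram_holdsD[of v "[]" a u b "[]"] in simp)

text \<open>These shapes are all that occur in rules 1 to 4, which thereby reduce to symmetries of
  the set relations.\<close>

lemma diagram_holds_arrow:
  "diagram_holds v [Var a, Rarr, Var b] \<longleftrightarrow> v a \<subseteq> v b"
  "diagram_holds v [Var a, Larr, Var b] \<longleftrightarrow> v b \<subseteq> v a"
  "diagram_holds v [Var a, Rarr, Bullet, Larr, Var b] \<longleftrightarrow> v a \<inter> v b = {}"
  "diagram_holds v [Var a, Larr, Bullet, Rarr, Var b] \<longleftrightarrow> v a \<inter> v b \<noteq> {}"
  "diagram_holds v [Var a, Larr, Bullet, Rarr, Bullet, Larr, Var b] \<longleftrightarrow> \<not> v a \<subseteq> v b"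
  "diagram_holds v [Var a, Rarr, Bullet, Larr, Bullet, Rarr, Var b] \<longleftrightarrow> \<not> v b \<subseteq> v a"
  using diagram_holds_single_segment[of "[Rarr]" v a b]
    diagram_holds_single_segment[of "[Larr]" v a b]
    diagram_holds_single_segment[of "[Rarr, Bullet, Larr]" v a b]
    diagram_holds_single_segment[of "[Larr, Bullet, Rarr]" v a b]
    diagram_holds_single_segment[of "[Larr, Bullet, Rarr, Bullet, Larr]" v a b]
    diagram_holds_single_segment[of "[Rarr, Bullet, Larr, Bullet, Rarr]" v a b]
  by (simp_all add: segment_holds_def)

lemma diagram_holds_syllogistic_diagram: "diagram_holds v (syllogistic_diagram c) \<longleftrightarrow> holds v c"
  by (cases c) (simp_all add: diagram_holds_arrow)

section \<open>Soundness of the rules and of proof trees\<close>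

lemma infer_sound:
  assumes "infer ps d" "\<And>p. p \<in> set ps \<Longrightarrow> diagram_holds v p"
  shows "diagram_holds v d"
  using assms
proof induction
  case (rule5 D a E)
  then show ?case using diagram_holds_overlap[of v D a E] by simp
next
  case (rule5_swap D a E)
  then show ?case using diagram_holds_overlap[of v D a E] by simp
next
  case (rule6 D a E)
  then show ?case using diagram_holds_erase[of v D Rarr a E] by simp
next
  case (rule7 D a E)
  then show ?case using diagram_holds_erase[of v D Larr a E] by simp
qed (auto simp: diagram_holds_arrow)

lemma proof_tree_sound:
  "proof_tree t \<Longrightarrow> (\<And>d. d \<in> leaves t \<Longrightarrow> diagram_holds v d) \<Longrightarrow> diagram_holds v (root t)"
proof (induction t)
  case (Node d ts)
  show ?case
  proof (cases "ts = []")
    case True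
    then show ?thesis using Node.prems by simp
  next
    case False
    then have leaves: "leaves (Node d ts) = (\<Union>t\<in>set ts. leaves t)"
      by simp
    have "diagram_holds v (root t)" if "t \<in> set ts" for t
    proof (rule Node.IH[OF that])
      show "proof_tree t"
        using that Node.prems(1) by simp
      show "diagram_holds v e" if "e \<in> leaves t" for e
        using that \<open>t \<in> set ts\<close> Node.prems(2) leaves by blast
    qed
    moreover have "infer (map root ts) d"
      using Node.prems(1) False by simp
    ultimately show ?thesis
      using infer_sound[of "map root ts" d v] by auto
  qed
qed

lemma provable_sound:
  assumes "provable (Syllogism p q c)" "holds v p" "holds v q"
  shows "holds v c"
  using assms proof_tree_sound
  unfolding provable_def formal_proof_def
  by (metis diagram_holds_syllogistic_diagram insert_iff empty_iff syllogism.sel)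

section \<open>Countermodels for the remaining syllogisms\<close>

lemma provable_imp_valid:
  assumes "distinct [S, P, M]" "\<sigma> \<in> syllogisms S P M" "provable \<sigma>"
  shows "\<sigma> \<in> valid_syllogisms S P M"
proof -
  obtain p q c where \<sigma>: "\<sigma> = Syllogism p q c"
    and p: "(subject p, predicate p) \<in> {(M, P), (P, M)}"
    and q: "(subject q, predicate q) \<in> {(S, M), (M, S)}"
    and c: "(subject c, predicate c) = (S, P)"
    using assms(2) unfolding syllogisms_def by blast
  define I :: "nat set \<Rightarrow> nat set \<Rightarrow> nat set \<Rightarrow> tvar \<Rightarrow> nat set"
    where "I s p m = (\<lambda>_. {})(S := s, P := p, M := m)" for s p m
  \<comment> \<open>Distinctness keeps the later updates from overwriting the earlier ones.\<close>
  have I: "I s p m S = s" "I s p m P = p" "I s p m M = m" for s p m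
    using assms(1) by (auto simp: I_def)
  have sound: "holds (I s r m) p \<Longrightarrow> holds (I s r m) q \<Longrightarrow> holds (I s r m) c" for s r m
    using provable_sound assms(3) \<sigma> by blast
  \<comment> \<open>The arguments are the values of \<open>S\<close>, \<open>P\<close>,
    \<open>M\<close>. The model with three empty sets, for instance, refutes every particular
    conclusion from two universal premises.\<close>
  note models =
    sound[of "{2}" "{0, 2}" "{1}"]
    sound[of "{0}" "{}" "{1}"]
    sound[of "{1}" "{0, 1}" "{0, 1}"]
    sound[of "{0}" "{1, 2}" "{2}"]
    sound[of "{1}" "{0}" "{1}"]
    sound[of "{0, 1}" "{1}" "{1}"]
    sound[of "{}" "{}" "{}"]
    sound[of "{0}" "{0, 1}" "{1}"]
    sound[of "{2}" "{0, 2}" "{1, 2}"]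
    sound[of "{1}" "{2}" "{0, 1, 2}"]
    sound[of "{0, 1, 2}" "{1}" "{2}"]
    sound[of "{1}" "{0, 1}" "{1}"]
  have "p \<in> {A_prop M P, A_prop P M, E_prop M P, E_prop P M,
      I_prop M P, I_prop P M, O_prop M P, O_prop P M}"
    using p by (cases p) auto
  moreover have "q \<in> {A_prop S M, A_prop M S, E_prop S M, E_prop M S,
      I_prop S M, I_prop M S, O_prop S M, O_prop M S}"
    using q by (cases q) auto
  moreover have "c \<in> {A_prop S P, E_prop S P, I_prop S P, O_prop S P}"
    using c by (cases c) auto
  ultimately show ?thesis
    unfolding \<sigma>
    \<comment> \<open>In each of the 8 * 8 * 4 = 256 cases, either the syllogism is listed or some
      model makes both premises true and the conclusion false.\<close>
    by (elim insertE emptyE; insert models; hypsubst; simp add: I valid_syllogisms_def)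
qed

theorem theorem3p15:
  fixes S P M :: tvar and \<sigma> :: syllogism
  assumes "distinct [S, P, M]"
    and "\<sigma> \<in> syllogisms S P M"
  shows "\<sigma> \<in> valid_syllogisms S P M \<longleftrightarrow> provable \<sigma>"
  using assms provable_imp_valid valid_imp_provable by blast

end
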